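(* Let $M$ be a finite set of prime numbers. The number of integers $x\in P_M$ such that $x-1$ and $x+1$ are both $M$-primes is $$\prod_{p_i\in M,\ p_i\neq 2}(p_i-2).$$
   Context: For a set $M$ of prime numbers, an $M$-prime is an integer (positive, negative or zero) not divisible by any of the primes in $M$. $P_M=\{x\in\mathbb{Z}: 0\le x<\prod_{p_i\in M}p_i\}$. An empty product equals $1$. *)

theory Defs
  imports "HOL-Computational_Algebra.Primes"
begin

definition M_prime :: "int set \<Rightarrow> int \<Rightarrow> bool" where
  "M_prime M x \<longleftrightarrow> (\<forall>p\<in>M. \<not> p dvd x)"

definition P_set :: "int set \<Rightarrow> int set" where
  "P_set M = {x. 0 \<le> x \<and> x < (\<Prod>p\<in>M. p)}"

end

theory Submission
  imports Defs "HOL-Number_Theory.Cong"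
begin

text \<open>Whether a prime p divides x - 1 or x + 1 depends only on x mod p. By the Chinese
  remainder theorem the integers in \<open>P_set M\<close> correspond to tuples of residues, one for
  each prime in M, so the count is a product of local counts. Modulo p the forbidden residues are 1
  and p - 1: they differ for odd p, leaving p - 2, and coincide for p = 2, leaving 1, which is why 2
  drops out of the product. The proof adjoins one prime at a time:
  \<open>card_coprime_residues\<close> gives multiplicativity and
  \<open>card_residues_not_dvd_neighbours\<close> the local factor.\<close>

text \<open>Chinese remainder theorem in counting form: sending x to its pair of residues makes
  conditions modulo a and modulo b independent.\<close>

lemma card_coprime_residues:
  fixes a b :: int
  assumes ab: "coprime a b" and pos: "a > 0" "b > 0"
    and A: "A \<subseteq> {0..<a}" and B: "B \<subseteq> {0..<b}"
  shows "card {x \<in> {0..<a * b}. x mod a \<in> A \<and> x mod b \<in> B} = card A * card B"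
proof -
  let ?S = "{x \<in> {0..<a * b}. x mod a \<in> A \<and> x mod b \<in> B}"
  have "bij_betw (\<lambda>x. (x mod a, x mod b)) ?S (A \<times> B)"
  proof (rule bij_betw_imageI)
    show "inj_on (\<lambda>x. (x mod a, x mod b)) ?S"
    proof (rule inj_onI)
      fix x y assume x: "x \<in> ?S" and y: "y \<in> ?S" and "(x mod a, x mod b) = (y mod a, y mod b)"
      then have "[x = y] (mod a)" "[x = y] (mod b)"
        by (simp_all add: cong_def)
      then have "[x = y] (mod a * b)"
        using ab by (rule coprime_cong_mult)
      with x y show "x = y"
        by (simp add: cong_def)
    qed
    show "(\<lambda>x. (x mod a, x mod b)) ` ?S = A \<times> B"
    proof (rule equalityI)
      show "A \<times> B \<subseteq> (\<lambda>x. (x mod a, x mod b)) ` ?S"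
      proof clarify
        fix u v assume uv: "u \<in> A" "v \<in> B"
        obtain x where "[x = u] (mod a)" "[x = v] (mod b)"
          using binary_chinese_remainder_int[OF ab] by blast
        moreover have "u mod a = u" "v mod b = v"
          using uv A B by auto
        \<comment> \<open>The solution x may lie outside the range; reducing it modulo a * b keeps
          both residues.\<close>
        ultimately have "(x mod (a * b)) mod a = u" "(x mod (a * b)) mod b = v"
          by (simp_all add: cong_def mod_mod_cancel)
        moreover have "x mod (a * b) \<in> {0..<a * b}"
          using pos by simp
        ultimately show "(u, v) \<in> (\<lambda>x. (x mod a, x mod b)) ` ?S"
          using uv by (intro image_eqI[where x = "x mod (a * b)"]) simp_all
      qed
    qed auto
  qed
  then show ?thesis
    by (simp add: bij_betw_same_card card_cartesian_product)
qed

text \<open>Applied with c = 1 and c = -1, this turns conditions on the neighbours of x into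
  conditions on a residue of x.\<close>

lemma dvd_mod_add_iff:
  fixes p d x c :: int
  assumes "p dvd d"
  shows "p dvd x mod d + c \<longleftrightarrow> p dvd x + c"
proof -
  have "(x mod d + c) mod p = (x + c) mod p"
    using assms by (metis mod_add_left_eq mod_mod_cancel)
  then show ?thesis
    by (simp add: dvd_eq_mod_eq_0)
qed

text \<open>The local factor: exactly 1 and p - 1 are excluded, and these are the same residue when
  p = 2.\<close>

lemma card_residues_not_dvd_neighbours:
  fixes p :: int
  assumes "prime p"
  shows "int (card {r \<in> {0..<p}. \<not> p dvd r - 1 \<and> \<not> p dvd r + 1}) = (if p = 2 then 1 else p - 2)"
proof -
  have p: "p \<ge> 2"
    using assms by (rule prime_ge_2_int)
  have "p dvd r - 1 \<longleftrightarrow> r = 1" if "r \<in> {0..<p}" for r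
  proof
    assume "p dvd r - 1"
    then have "r mod p = 1 mod p"
      by (simp add: mod_eq_dvd_iff)
    with that p show "r = 1" by simp
  qed simp
  moreover have "p dvd r + 1 \<longleftrightarrow> r = p - 1" if "r \<in> {0..<p}" for r
  proof
    assume "p dvd r + 1"
    \<comment> \<open>Here r + 1 is positive and at most p, so being a multiple of p forces
      equality.\<close>
    then have "p \<le> r + 1"
      using that by (intro zdvd_imp_le) auto
    with that show "r = p - 1" by simp
  qed simp
  ultimately have "{r \<in> {0..<p}. \<not> p dvd r - 1 \<and> \<not> p dvd r + 1} = {0..<p} - {1, p - 1}"
    by auto
  also have "int (card \<dots>) = (if p = 2 then 1 else p - 2)"
    using p by (auto simp: card_Diff_subset)
  finally show ?thesis .
qed

theorem mainTheorem10:
  fixes M :: "int set"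
  assumes "finite M"
    and "\<And>p. p \<in> M \<Longrightarrow> prime p"
  shows "int (card {x \<in> P_set M. M_prime M (x - 1) \<and> M_prime M (x + 1)})
       = (\<Prod>p\<in>M - {2}. p - 2)"
  using assms
proof (induction M rule: finite_induct)
  case empty
  have "{x::int. 0 \<le> x \<and> x < 1} = {0}" by auto
  then show ?case
    by (simp add: P_set_def M_prime_def)
next
  case (insert p M)
  let ?N = "\<Prod>M"
  let ?S = "{x \<in> P_set M. M_prime M (x - 1) \<and> M_prime M (x + 1)}"
  let ?T = "{x \<in> P_set (insert p M). M_prime (insert p M) (x - 1) \<and> M_prime (insert p M) (x + 1)}"
  let ?R = "{r \<in> {0..<p}. \<not> p dvd r - 1 \<and> \<not> p dvd r + 1}"
  have p: "prime p" and M: "\<And>q. q \<in> M \<Longrightarrow> prime q"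
    using insert.prems by auto
  \<comment> \<open>Since p is not in M, it is a prime distinct from every factor of
    \<open>?N\<close>.\<close>
  have cop: "coprime p ?N"
    using p M insert.hyps(2) by (intro prod_coprime_right) (metis primes_coprime)
  have pos: "p > 0" "?N > 0"
    using p M by (auto intro!: prod_pos simp: prime_gt_0_int)
  have M_prime_insert: "M_prime (insert p M) y \<longleftrightarrow> \<not> p dvd y \<and> M_prime M y" for y
    by (simp add: M_prime_def)
  have p_mod: "p dvd x mod p + c \<longleftrightarrow> p dvd x + c" for x c
    by (rule dvd_mod_add_iff) simp
  \<comment> \<open>Every prime in M divides \<open>?N\<close>, so reduction modulo
    \<open>?N\<close> is invisible to it.\<close>
  have M_prime_mod: "M_prime M (x mod ?N + c) \<longleftrightarrow> M_prime M (x + c)" for x c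
    unfolding M_prime_def
    using dvd_prodI[OF insert.hyps(1), where f = "\<lambda>q. q"] by (simp add: dvd_mod_add_iff)
  \<comment> \<open>This splits the condition for the enlarged set into one on x mod p and one on x
    mod \<open>?N\<close>, the latter being the set counted by the induction hypothesis.\<close>
  have crt: "?T = {x \<in> {0..<p * ?N}. x mod p \<in> ?R \<and> x mod ?N \<in> ?S}"
  proof (rule Collect_cong)
    fix x
    have "x \<in> P_set (insert p M) \<longleftrightarrow> x \<in> {0..<p * ?N}"
      using insert.hyps by (simp add: P_set_def)
    moreover have "x mod p \<in> ?R \<longleftrightarrow> \<not> p dvd x - 1 \<and> \<not> p dvd x + 1"
      using pos p_mod[of x 1] p_mod[of x "- 1"] by simp
    moreover have "x mod ?N \<in> ?S \<longleftrightarrow> M_prime M (x - 1) \<and> M_prime M (x + 1)"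
      using pos M_prime_mod[of x 1] M_prime_mod[of x "- 1"] by (simp add: P_set_def)
    ultimately show "x \<in> P_set (insert p M) \<and> M_prime (insert p M) (x - 1) \<and> M_prime (insert p M) (x + 1)
        \<longleftrightarrow> x \<in> {0..<p * ?N} \<and> x mod p \<in> ?R \<and> x mod ?N \<in> ?S"
      unfolding M_prime_insert by argo
  qed
  have "card ?T = card ?R * card ?S"
    unfolding crt using cop pos by (intro card_coprime_residues) (auto simp: P_set_def)
  then have "int (card ?T) = int (card ?R) * int (card ?S)"
    by (simp only: of_nat_mult)
  also have "\<dots> = (if p = 2 then 1 else p - 2) * (\<Prod>q\<in>M - {2}. q - 2)"
    by (simp only: card_residues_not_dvd_neighbours[OF p] insert.IH[OF M])
  \<comment> \<open>If p = 2, the factor 1 matches the removal of 2 from the index set; otherwise p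
    is a new index contributing p - 2.\<close>
  also have "\<dots> = (\<Prod>q\<in>insert p M - {2}. q - 2)"
    using insert.hyps by (cases "p = 2") (simp_all add: insert_Diff_if)
  finally show ?case .
qed

end
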